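(* Any mild solution $(u,u^* )\in C([0,\infty);W^1\times W^2)$ of the system $$\alpha\,\partial_t u-\mathrm{d}^*u^*=-\beta u \ \text{ in } W^1,\qquad \gamma\,\partial_t u^*+\mathrm{d}u=0\ \text{ in } W^2,\qquad t\ge 0,$$ which satisfies the compatibility condition $\gamma u^*(0)\in\mathcal{R}(\mathrm{d})$, decays exponentially, i.e., $$\|u(t)\|_\alpha^2+\|u^*(t)\|_\gamma^2\le C'e^{-c'(t-s)}\big(\|u(s)\|_\alpha^2+\|u^*(s)\|_\gamma^2\big)\qquad\text{for all } 0\le s\le t,$$ with constants $C',c'>0$ independent of the particular solution.
   Context: $W^1,W^2$ are real Hilbert spaces with scalar products $\langle\cdot,\cdot\rangle_{W^1}$, $\langle\cdot,\cdot\rangle_{W^2}$. $\mathrm{d}:V^1\subset W^1\to W^2$ is a densely defined closed linear operator with domain $V^1$ and range $\mathcal{R}(\mathrm{d})=\mathrm{d}V^1$. $\mathrm{d}^*:V_2^*\subset W^2\to W^1$ is its adjoint with domain $V_2^*$, i.e. $\langle \mathrm{d}^*u^*,u\rangle_{W^1}=\langle u^*,\mathrm{d}u\rangle_{W^2}$ for all $u\in V^1$, $u^*\in V_2^*$; it is again densely defined and closed. The spaces and operators form a segment of a Hilbert complex. $\alpha,\beta:W^1\to W^1$ and $\gamma:W^2\to W^2$ are selfadjoint positive isomorphisms. Write $\|u\|_\alpha^2=\langle\alpha u,u\rangle_{W^1}$ and $\|u^*\|_\gamma^2=\langle\gamma u^*,u^*\rangle_{W^2}$; these norms are equivalent to the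 natural norms of $W^1$ and $W^2$. A mild solution is understood in the sense of semigroup theory: with $X=W^1\times W^2$, $x=(u,u^* )$ and $A(u,u^* )=(\alpha^{-1}(\mathrm{d}^*u^*-\beta u),-\gamma^{-1}\mathrm{d}u)$ on the domain $\mathcal{D}(A)=V^1\times V_2^*$, a function $x\in C([0,\infty);X)$ is a mild solution if $\int_0^t x(s)\,ds\in\mathcal{D}(A)$ and $x(t)=x(0)+A\int_0^t x(s)\,ds$ for all $t\ge0$.
   Formalization: The range R(d) is additionally assumed to be closed; without this the claim with uniform constants fails, e.g. for d = diag(1/n) on l^2 with α, β, γ the identity. *)

theory Defs
  imports "HOL-Analysis.Analysis"
begin

text \<open>
  A Hilbert space is a type of sort \<open>{real_inner, banach}\<close>. An unbounded operator is a pair of its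
  domain \<open>V\<close> and a total function \<open>d\<close>, whose values outside \<open>V\<close> are irrelevant.
\<close>

definition closed_densely_defined_op ::
  "'a::{real_inner,banach} set \<Rightarrow> ('a \<Rightarrow> 'b::{real_inner,banach}) \<Rightarrow> bool" where
  "closed_densely_defined_op V d \<longleftrightarrow>
     subspace V \<and>
     (\<forall>x\<in>V. \<forall>y\<in>V. d (x + y) = d x + d y) \<and>
     (\<forall>x\<in>V. \<forall>r. d (r *\<^sub>R x) = r *\<^sub>R d x) \<and>
     closure V = UNIV \<and>
     closed ((\<lambda>x. (x, d x)) ` V)"

definition adjoint_dom ::
  "'a::{real_inner,banach} set \<Rightarrow> ('a \<Rightarrow> 'b::{real_inner,banach}) \<Rightarrow> 'b set" where
  "adjoint_dom V d = {v. \<exists>w. \<forall>u\<in>V. inner w u = inner v (d u)}"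

text \<open>The description is proper on \<open>adjoint_dom V d\<close> because \<open>V\<close> is dense.\<close>

definition adjoint_op ::
  "'a::{real_inner,banach} set \<Rightarrow> ('a \<Rightarrow> 'b::{real_inner,banach}) \<Rightarrow> 'b \<Rightarrow> 'a" where
  "adjoint_op V d v = (THE w. \<forall>u\<in>V. inner w u = inner v (d u))"

lemma adjoint_op_unique:
  fixes d :: "'a::{real_inner,banach} \<Rightarrow> 'b::{real_inner,banach}"
  assumes "closure V = UNIV"
    and w: "\<forall>u\<in>V. inner w u = inner v (d u)" and w': "\<forall>u\<in>V. inner w' u = inner v (d u)"
  shows "w = w'"
proof -
  have "closed {u. inner (w - w') u = 0}"
    by (intro closed_Collect_eq continuous_intros)
  moreover have "V \<subseteq> {u. inner (w - w') u = 0}"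
    using w w' by (auto simp: inner_diff_left)
  ultimately have "closure V \<subseteq> {u. inner (w - w') u = 0}"
    by (rule closure_minimal[rotated])
  then have "inner (w - w') (w - w') = 0"
    unfolding assms(1) by blast
  then show ?thesis by simp
qed

lemma inner_adjoint_op:
  fixes d :: "'a::{real_inner,banach} \<Rightarrow> 'b::{real_inner,banach}"
  assumes "closed_densely_defined_op V d" "v \<in> adjoint_dom V d" "u \<in> V"
  shows "inner (adjoint_op V d v) u = inner v (d u)"
proof -
  have dense: "closure V = UNIV"
    using assms(1) by (simp add: closed_densely_defined_op_def)
  obtain w where w: "\<forall>u\<in>V. inner w u = inner v (d u)"
    using assms(2) by (auto simp: adjoint_dom_def)
  have "\<forall>u\<in>V. inner (adjoint_op V d v) u = inner v (d u)"
    unfolding adjoint_op_def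
    by (rule theI[where P = "\<lambda>w. \<forall>u\<in>V. inner w u = inner v (d u)", OF w])
      (rule adjoint_op_unique[OF dense _ w])
  then show ?thesis using assms(3) by blast
qed

definition selfadjoint_positive_iso :: "('a::{real_inner,banach} \<Rightarrow> 'a) \<Rightarrow> bool" where
  "selfadjoint_positive_iso T \<longleftrightarrow>
     bounded_linear T \<and> bij T \<and> bounded_linear (inv T) \<and>
     (\<forall>x y. inner (T x) y = inner x (T y)) \<and>
     (\<forall>x. x \<noteq> 0 \<longrightarrow> inner (T x) x > 0)"

definition weighted_norm :: "('a::real_inner \<Rightarrow> 'a) \<Rightarrow> 'a \<Rightarrow> real" where
  "weighted_norm T x = sqrt (inner (T x) x)"

definition generator_dom ::
  "'a::{real_inner,banach} set \<Rightarrow> ('a \<Rightarrow> 'b::{real_inner,banach}) \<Rightarrow> ('a \<times> 'b) set" where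
  "generator_dom V d = V \<times> adjoint_dom V d"

definition generator ::
  "'a::{real_inner,banach} set \<Rightarrow> ('a \<Rightarrow> 'b::{real_inner,banach}) \<Rightarrow>
   ('a \<Rightarrow> 'a) \<Rightarrow> ('a \<Rightarrow> 'a) \<Rightarrow> ('b \<Rightarrow> 'b) \<Rightarrow> 'a \<times> 'b \<Rightarrow> 'a \<times> 'b" where
  "generator V d \<alpha> \<beta> \<gamma> = (\<lambda>(u, v). (inv \<alpha> (adjoint_op V d v - \<beta> u), - inv \<gamma> (d u)))"

definition mild_solution ::
  "'x::banach set \<Rightarrow> ('x \<Rightarrow> 'x) \<Rightarrow> (real \<Rightarrow> 'x) \<Rightarrow> bool" where
  "mild_solution D A x \<longleftrightarrow>
     continuous_on {0..} x \<and>
     (\<forall>t\<ge>0. integral {0..t} x \<in> D \<and> x t = x 0 + A (integral {0..t} x))"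

end

theory Submission
  imports Defs
begin

text \<open>
  Only the component \<open>u\<close> is damped: along a differentiable solution the energy
  \<open>E = \<langle>\<alpha> u, u\<rangle> + \<langle>\<gamma> v, v\<rangle>\<close> satisfies \<open>E' = - 2 \<langle>\<beta> u, u\<rangle>\<close>, because the contributions of \<open>d\<close> and of
  its adjoint cancel. The missing dissipation of \<open>v\<close> comes from a multiplier. The second equation
  keeps \<open>\<gamma> v\<close> in the range of \<open>d\<close> if it starts there, so that \<open>\<gamma> v = d w\<close> with \<open>w = S (\<gamma> v)\<close>, where
  \<open>S\<close> is the pseudo-inverse of \<open>d\<close>, and testing the first equation with \<open>w\<close> gives
  \<open>\<langle>\<alpha> u, w\<rangle>' = \<langle>\<gamma> v, v\<rangle> - \<langle>\<beta> u, w\<rangle> - \<langle>\<alpha> u, S (d u)\<rangle>\<close>. Since \<open>S\<close> is bounded and \<open>S (d u)\<close> is no longer than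
  \<open>u\<close>, all terms but the first are controlled by the damping of \<open>u\<close> and a small part of
  \<open>\<langle>\<gamma> v, v\<rangle>\<close>. For small \<open>\<epsilon>\<close> the functional \<open>F = E - \<epsilon> \<langle>\<alpha> u, w\<rangle>\<close> is therefore equivalent to \<open>E\<close> and
  satisfies \<open>F' \<le> - c F\<close>, which is exponential decay (\<open>strict_solution_decay\<close>).

  The pseudo-inverse (\<open>bounded_pseudo_inverse_exists\<close>) is the main use of the closed range. It assigns
  to \<open>d x\<close> the component of \<open>x\<close> orthogonal to the kernel of \<open>d\<close>. This needs orthogonal projections in
  Hilbert spaces (\<open>orthogonal_projection_exists\<close>), and its boundedness is the open mapping theorem for
  \<open>d\<close>, proved by Baire's category theorem (\<open>closed_range_bounded_preimages\<close>).

  A mild solution need not be differentiable, but its averages over \<open>[t, t + h]\<close> are: they are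
  difference quotients of the integrated solution, which lies in the domain of the generator, and
  they solve the same system by linearity. They converge to the solution as \<open>h\<close> tends to \<open>0\<close>,
  and the decay estimate, whose constants depend neither on the solution nor on \<open>h\<close>, passes to the
  limit (\<open>mild_solution_decay\<close>).
\<close>

section \<open>Coercivity of positive isomorphisms\<close>

text \<open>
  The form \<open>\<langle>T x, x\<rangle>\<close> is nonnegative at \<open>x - r *\<^sub>R T x\<close>. As in the proof of the Cauchy--Schwarz
  inequality, a good choice of \<open>r\<close> bounds the square of \<open>norm (T x)\<close> by a multiple of \<open>\<langle>T x, x\<rangle>\<close>; boundedness
  of the inverse then bounds \<open>norm x\<close> by \<open>norm (T x)\<close>.
\<close>

lemma selfadjoint_positive_iso_coercive:
  fixes T :: "'a::{real_inner,banach} \<Rightarrow> 'a"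
  assumes "selfadjoint_positive_iso T"
  obtains c where "c > 0" "\<And>x. c * (norm x)\<^sup>2 \<le> inner (T x) x"
proof -
  interpret T: bounded_linear T using assms by (simp add: selfadjoint_positive_iso_def)
  interpret I: bounded_linear "inv T" using assms by (simp add: selfadjoint_positive_iso_def)
  have sym: "inner (T x) y = inner x (T y)" for x y
    using assms by (simp add: selfadjoint_positive_iso_def)
  have nonneg: "inner (T x) x \<ge> 0" for x
    using assms by (cases "x = 0") (auto simp: selfadjoint_positive_iso_def T.zero less_imp_le)
  obtain M where M: "M > 0" "\<And>x. norm (T x) \<le> norm x * M" using T.pos_bounded by auto
  obtain N where N: "N > 0" "\<And>x. norm (inv T x) \<le> norm x * N" using I.pos_bounded by auto
  have lower: "(norm (T x))\<^sup>2 \<le> M * inner (T x) x" for x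
  proof -
    define q where "q = (norm (T x))\<^sup>2"
    have q0: "q \<ge> 0" by (simp add: q_def)
    have q: "inner (T x) (T x) = q" "inner (T (T x)) x = q"
      by (simp_all add: q_def power2_norm_eq_inner sym)
    have "inner (T (T x)) (T x) \<le> norm (T (T x)) * norm (T x)" by (rule norm_cauchy_schwarz)
    also have "\<dots> \<le> norm (T x) * M * norm (T x)" using M by (intro mult_right_mono) auto
    finally have TT: "inner (T (T x)) (T x) \<le> M * q" by (simp add: q_def power2_eq_square mult_ac)
    \<comment> \<open>\<open>1 / M\<close> minimises the upper bound for the form of \<open>x - r *\<^sub>R T x\<close>.\<close>
    have "0 \<le> inner (T (x - (1 / M) *\<^sub>R T x)) (x - (1 / M) *\<^sub>R T x)" by (rule nonneg)
    also have "\<dots> = inner (T x) x - 2 * q / M + inner (T (T x)) (T x) / M\<^sup>2"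
      by (simp add: T.diff T.scaleR inner_diff_left inner_diff_right q power2_eq_square
          diff_divide_distrib)
    also have "inner (T (T x)) (T x) / M\<^sup>2 \<le> q / M"
      using divide_right_mono[OF TT, of "M\<^sup>2"] M(1) by (simp add: power2_eq_square)
    finally have "q / M \<le> inner (T x) x" by simp
    then show ?thesis using M(1) by (simp add: q_def field_simps)
  qed
  have "(norm x)\<^sup>2 \<le> N\<^sup>2 * M * inner (T x) x" for x
  proof -
    have "inv T (T x) = x"
      using assms by (simp add: selfadjoint_positive_iso_def bij_is_inj)
    then have "norm x \<le> norm (T x) * N" using N(2)[of "T x"] by simp
    then have "(norm x)\<^sup>2 \<le> (norm (T x))\<^sup>2 * N\<^sup>2"
      by (metis norm_ge_zero power_mono power_mult_distrib)
    also have "\<dots> \<le> (M * inner (T x) x) * N\<^sup>2" using lower by (intro mult_right_mono) auto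
    finally show ?thesis by (simp add: mult_ac)
  qed
  then have "1 / (N\<^sup>2 * M) * (norm x)\<^sup>2 \<le> inner (T x) x" for x
    using N(1) M(1) by (simp add: field_simps)
  moreover have "1 / (N\<^sup>2 * M) > 0" using N(1) M(1) by simp
  ultimately show thesis using that by blast
qed

section \<open>Orthogonal projections in Hilbert spaces\<close>

text \<open>
  By the parallelogram identity, a minimising sequence for the distance from \<open>x\<close> to \<open>K\<close> is a Cauchy
  sequence, since the midpoints of its members lie in \<open>K\<close> as well.
\<close>

lemma nearest_point_closed_subspace:
  fixes K :: "'a::{real_inner,banach} set"
  assumes K: "subspace K" "closed K"
  obtains p where "p \<in> K" "\<And>k. k \<in> K \<Longrightarrow> norm (x - p) \<le> norm (x - k)"
proof -
  define D where "D = (INF k\<in>K. (norm (x - k))\<^sup>2)"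
  have K0: "K \<noteq> {}" using K(1) subspace_0 by auto
  have bdd: "bdd_below ((\<lambda>k. (norm (x - k))\<^sup>2) ` K)" by (intro bdd_belowI[of _ 0]) auto
  have D: "D \<le> (norm (x - k))\<^sup>2" if "k \<in> K" for k
    unfolding D_def using bdd that by (rule cINF_lower)
  have "\<exists>k\<in>K. (norm (x - k))\<^sup>2 < D + 1 / real (Suc n)" for n
    using cINF_less_iff[OF K0 bdd, of "D + 1 / real (Suc n)"] by (simp add: D_def)
  then obtain k where k: "\<And>n. k n \<in> K" "\<And>n. (norm (x - k n))\<^sup>2 < D + 1 / real (Suc n)"
    by metis
  have gap: "(norm (k m - k n))\<^sup>2 \<le> 2 / real (Suc m) + 2 / real (Suc n)" for m n
  proof -
    have mid: "(1 / 2) *\<^sub>R (k m + k n) \<in> K"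
      using K(1) k(1) by (simp add: subspace_add subspace_scale)
    have "(norm (k m - k n))\<^sup>2 = 2 * (norm (x - k m))\<^sup>2 + 2 * (norm (x - k n))\<^sup>2
        - 4 * (norm (x - (1 / 2) *\<^sub>R (k m + k n)))\<^sup>2"
      by (simp add: power2_norm_eq_inner inner_diff_left inner_diff_right inner_add_left
          inner_add_right inner_commute algebra_simps)
    then show ?thesis using D[OF mid] k(2)[of m] k(2)[of n] by linarith
  qed
  have "Cauchy k"
  proof (rule metric_CauchyI)
    fix e :: real assume e: "e > 0"
    obtain N where N: "inverse (real (Suc N)) < e\<^sup>2 / 4"
      using reals_Archimedean[of "e\<^sup>2 / 4"] e by auto
    have "dist (k m) (k n) < e" if "m \<ge> N" "n \<ge> N" for m n
    proof -
      have "1 / real (Suc j) \<le> inverse (real (Suc N))" if "j \<ge> N" for j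
        using that by (simp add: field_simps)
      from this[OF that(1)] this[OF that(2)] have "(norm (k m - k n))\<^sup>2 < e\<^sup>2"
        using gap[of m n] N by simp
      then show ?thesis using e by (simp add: dist_norm power_less_imp_less_base)
    qed
    then show "\<exists>M. \<forall>m\<ge>M. \<forall>n\<ge>M. dist (k m) (k n) < e" by blast
  qed
  then obtain p where p: "k \<longlonglongrightarrow> p" using Cauchy_convergent_iff convergent_def by blast
  have "p \<in> K" using closed_sequentially[OF K(2) _ p] k(1) by blast
  moreover have "norm (x - p) \<le> norm (x - q)" if "q \<in> K" for q
  proof -
    have "(\<lambda>n. (norm (x - k n))\<^sup>2) \<longlonglongrightarrow> (norm (x - p))\<^sup>2" by (intro tendsto_intros p)
    moreover have "(\<lambda>n. D + 1 / real (Suc n)) \<longlonglongrightarrow> D + 0"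
      by (intro tendsto_intros lim_1_over_n[THEN LIMSEQ_Suc])
    ultimately have "(norm (x - p))\<^sup>2 \<le> D + 0"
      by (rule LIMSEQ_le) (use k(2) in \<open>auto intro: less_imp_le\<close>)
    also have "\<dots> \<le> (norm (x - q))\<^sup>2" using D[OF that] by simp
    finally show ?thesis by (simp add: power2_le_iff_abs_le)
  qed
  ultimately show thesis using that by blast
qed

text \<open>
  The error of the nearest point is orthogonal to \<open>K\<close>, since otherwise a step along \<open>K\<close> would shorten
  it. Orthogonality determines the point uniquely, hence the projection is linear.
\<close>

lemma orthogonal_projection_exists:
  fixes K :: "'a::{real_inner,banach} set"
  assumes K: "subspace K" "closed K"
  obtains P where "bounded_linear P" "\<And>x. P x \<in> K" "\<And>x k. k \<in> K \<Longrightarrow> inner (x - P x) k = 0"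
    "\<And>k. k \<in> K \<Longrightarrow> P k = k" "\<And>x. norm (x - P x) \<le> norm x"
proof -
  have "\<exists>p\<in>K. \<forall>k\<in>K. inner (x - p) k = 0" for x
  proof -
    obtain p where p: "p \<in> K" "\<And>k. k \<in> K \<Longrightarrow> norm (x - p) \<le> norm (x - k)"
      using nearest_point_closed_subspace[OF K] by blast
    have "inner (x - p) k = 0" if k: "k \<in> K" for k
    proof (cases "k = 0")
      case False
      define r where "r = inner (x - p) k / inner k k"
      have "p + r *\<^sub>R k \<in> K" using K(1) p(1) k by (simp add: subspace_add subspace_scale)
      then have "norm (x - p) \<le> norm (x - p - r *\<^sub>R k)" using p(2) by (simp add: diff_diff_eq)
      then have "(norm (x - p))\<^sup>2 \<le> (norm (x - p - r *\<^sub>R k))\<^sup>2" by (simp add: power_mono)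
      also have "\<dots> = (norm (x - p))\<^sup>2 - (inner (x - p) k)\<^sup>2 / inner k k"
        unfolding power2_norm_eq_inner
        using False by (simp add: inner_diff_left[of "x - p"] inner_diff_right[of _ "x - p"]
            inner_commute[of k "x - p"] r_def power2_eq_square)
      finally have "(inner (x - p) k)\<^sup>2 / inner k k \<le> 0" by simp
      moreover have "inner k k > 0" using False by simp
      ultimately show ?thesis by (simp add: divide_le_0_iff)
    qed simp
    then show ?thesis using p(1) by blast
  qed
  then obtain P where P: "\<And>x. P x \<in> K" "\<And>x k. k \<in> K \<Longrightarrow> inner (x - P x) k = 0" by metis
  have uniq: "P x = p" if "p \<in> K" "\<And>k. k \<in> K \<Longrightarrow> inner (x - p) k = 0" for x p
  proof -
    have mem: "P x - p \<in> K" using K(1) P(1) that(1) by (simp add: subspace_diff)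
    have "inner (P x - p) (P x - p) = inner (x - p) (P x - p) - inner (x - P x) (P x - p)"
      by (simp add: inner_diff_left)
    also have "\<dots> = 0" using P(2)[OF mem] that(2)[OF mem] by simp
    finally show ?thesis by simp
  qed
  have pyth: "(norm (P x))\<^sup>2 + (norm (x - P x))\<^sup>2 = (norm x)\<^sup>2" for x
    using P(2)[OF P(1), of x x]
    by (simp add: power2_norm_eq_inner inner_diff_left inner_diff_right inner_commute)
  have "norm (P x) \<le> norm x" for x
    by (rule power2_le_imp_le) (use pyth[of x] zero_le_power2[of "norm (x - P x)"] in linarith, simp)
  moreover have "norm (x - P x) \<le> norm x" for x
    by (rule power2_le_imp_le) (use pyth[of x] zero_le_power2[of "norm (P x)"] in linarith, simp)
  ultimately have bounds: "norm (P x) \<le> norm x" "norm (x - P x) \<le> norm x" for x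
    by blast+
  have "bounded_linear P"
  proof (rule bounded_linear_intro[where K = 1])
    show "P (x + y) = P x + P y" for x y
    proof (rule uniq)
      show "P x + P y \<in> K" using K(1) P(1) by (simp add: subspace_add)
      show "inner (x + y - (P x + P y)) k = 0" if "k \<in> K" for k
        using P(2)[OF that, of x] P(2)[OF that, of y] by (simp add: inner_diff_left inner_add_left)
    qed
    show "P (r *\<^sub>R x) = r *\<^sub>R P x" for r x
    proof (rule uniq)
      show "r *\<^sub>R P x \<in> K" using K(1) P(1) by (simp add: subspace_scale)
      show "inner (r *\<^sub>R x - r *\<^sub>R P x) k = 0" if "k \<in> K" for k
        using P(2)[OF that, of x] by (simp add: inner_diff_left)
    qed
  qed (use bounds in auto)
  then show thesis using that P bounds uniq by fastforce
qed

text \<open>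
  The projection onto \<open>K\<close> fixes \<open>f\<close> on the domain of integration and commutes with the integral.
\<close>

lemma integral_in_closed_subspace:
  fixes f :: "'n::euclidean_space \<Rightarrow> 'a::{real_inner,banach}"
  assumes K: "subspace K" "closed K" and f: "f integrable_on S" "\<And>x. x \<in> S \<Longrightarrow> f x \<in> K"
  shows "integral S f \<in> K"
proof -
  obtain P where P: "bounded_linear P" "\<And>x. P x \<in> K"
      "\<And>x k. k \<in> K \<Longrightarrow> inner (x - P x) k = 0" "\<And>k. k \<in> K \<Longrightarrow> P k = k"
      "\<And>x. norm (x - P x) \<le> norm x"
    by (fact orthogonal_projection_exists[OF K])
  have "P (integral S f) = integral S (P \<circ> f)" using integral_linear[OF f(1) P(1)] by simp
  also have "\<dots> = integral S f" using f(2) P(4) by (intro integral_cong) simp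
  finally show ?thesis using P(2) by metis
qed

section \<open>Closed operators with closed range\<close>

lemma closed_densely_defined_op_scaleR:
  assumes "closed_densely_defined_op V d" "x \<in> V"
  shows "d (r *\<^sub>R x) = r *\<^sub>R d x"
  using assms by (simp add: closed_densely_defined_op_def)

lemma closed_densely_defined_op_diff:
  assumes "closed_densely_defined_op V d" "x \<in> V" "y \<in> V"
  shows "d (x - y) = d x - d y"
proof -
  have V: "subspace V" and add: "\<And>x y. x \<in> V \<Longrightarrow> y \<in> V \<Longrightarrow> d (x + y) = d x + d y"
    using assms by (auto simp: closed_densely_defined_op_def)
  note neg = closed_densely_defined_op_scaleR[OF assms(1,3), of "- 1"]
  have "d (x + (- 1) *\<^sub>R y) = d x + d ((- 1) *\<^sub>R y)"
    using assms V by (intro add subspace_scale)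
  then show ?thesis unfolding neg by simp
qed

lemma closed_kernel:
  assumes d: "closed_densely_defined_op V d"
  shows "subspace {x \<in> V. d x = 0}" "closed {x \<in> V. d x = 0}"
proof -
  have V: "subspace V" using d by (simp add: closed_densely_defined_op_def)
  have "d 0 = 0"
    using closed_densely_defined_op_scaleR[OF d subspace_0[OF V], of 0] by simp
  then show "subspace {x \<in> V. d x = 0}"
    using d by (auto simp: closed_densely_defined_op_def subspace_def)
  have "{x \<in> V. d x = 0} = (\<lambda>x. (x, 0)) -` ((\<lambda>x. (x, d x)) ` V)" by auto
  moreover have "closed ((\<lambda>x. (x, 0)) -` ((\<lambda>x. (x, d x)) ` V))"
    using d by (intro closed_vimage continuous_intros) (simp add: closed_densely_defined_op_def)
  ultimately show "closed {x \<in> V. d x = 0}" by simp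
qed

lemma subspace_range:
  assumes d: "closed_densely_defined_op V d"
  shows "subspace (d ` V)"
proof (rule subspaceI)
  have V: "subspace V" and add: "\<And>x y. x \<in> V \<Longrightarrow> y \<in> V \<Longrightarrow> d (x + y) = d x + d y"
    using d by (auto simp: closed_densely_defined_op_def)
  note scale = closed_densely_defined_op_scaleR[OF d]
  show "0 \<in> d ` V" using scale[OF subspace_0[OF V], of 0] subspace_0[OF V] by (metis imageI scaleR_zero_left)
  show "a + b \<in> d ` V" if "a \<in> d ` V" "b \<in> d ` V" for a b
    using that subspace_add[OF V] by (metis (no_types, lifting) add imageE imageI)
  show "r *\<^sub>R a \<in> d ` V" if "a \<in> d ` V" for r a
    using that subspace_scale[OF V] by (metis (no_types, lifting) scale imageE imageI)
qed

text \<open>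
  The open mapping theorem for \<open>d\<close>. The range is a complete metric space and the union of the closures
  \<open>T n\<close> of the images of the balls of radius \<open>n\<close> in \<open>V\<close>. By Baire one of them has an interior point,
  which yields approximate preimages of controlled norm. Correcting the error again and again gives a
  convergent series, and its sum is an exact preimage because the graph is closed.
\<close>

lemma closed_range_bounded_preimages:
  fixes d :: "'a::{real_inner,banach} \<Rightarrow> 'b::{real_inner,banach}"
  assumes d: "closed_densely_defined_op V d" and closed_range: "closed (d ` V)"
  obtains C where "\<And>y. y \<in> d ` V \<Longrightarrow> \<exists>x\<in>V. d x = y \<and> norm x \<le> C * norm y"
proof -
  have V: "subspace V" and graph: "closed ((\<lambda>x. (x, d x)) ` V)"
    and add: "\<And>x y. x \<in> V \<Longrightarrow> y \<in> V \<Longrightarrow> d (x + y) = d x + d y"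
    and scale: "\<And>r x. x \<in> V \<Longrightarrow> d (r *\<^sub>R x) = r *\<^sub>R d x"
    using d by (auto simp: closed_densely_defined_op_def)
  have V0: "0 \<in> V" and d0: "d 0 = 0" using subspace_0[OF V] scale[of 0 0] by auto
  note diff = closed_densely_defined_op_diff[OF d] and sub = subspace_range[OF d]
  define T where "T n = closure (d ` {x \<in> V. norm x \<le> real n})" for n
  have TR: "T n \<subseteq> d ` V" for n unfolding T_def using closed_range by (intro closure_minimal) auto
  have "\<Union> (range T) = d ` V"
  proof
    show "d ` V \<subseteq> \<Union> (range T)"
    proof (rule image_subsetI)
      fix x assume "x \<in> V"
      moreover obtain n where "norm x \<le> real n" using real_arch_simple by blast
      ultimately have "d x \<in> T n" unfolding T_def by (intro closure_subset[THEN subsetD]) auto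
      then show "d x \<in> \<Union> (range T)" by blast
    qed
  qed (use TR in blast)
  then have "top_of_set (d ` V) interior_of \<Union> (range T) = d ` V"
    by (metis interior_of_topspace topspace_euclidean_subtopology)
  then have nonempty: "top_of_set (d ` V) interior_of \<Union> (range T) \<noteq> {}"
    using V0 by (metis empty_iff imageI)
  have "completely_metrizable_space (top_of_set (d ` V))"
    using closed_range unfolding closed_closedin
    by (rule completely_metrizable_space_closedin[OF completely_metrizable_space_euclidean])
  moreover have "closedin (top_of_set (d ` V)) (T n)" for n
    using TR by (simp add: T_def closed_subset)
  ultimately have "\<exists>n. top_of_set (d ` V) interior_of T n \<noteq> {}"
    using nonempty Baire_category_alt[of "top_of_set (d ` V)" "range T"]
    by (metis countableI_type countable_image imageE)
  then obtain n y0 where "y0 \<in> top_of_set (d ` V) interior_of T n" by blast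
  then obtain U where "openin (top_of_set (d ` V)) U" "y0 \<in> U" "U \<subseteq> T n"
    by (auto simp: interior_of_def)
  then obtain \<delta> where "\<delta> > 0" and ball: "ball y0 \<delta> \<inter> d ` V \<subseteq> T n" and y0: "y0 \<in> d ` V"
    unfolding openin_contains_ball by (meson order_trans subsetD)
  then have \<delta>: "\<delta> > 0" "\<And>y. y \<in> d ` V \<Longrightarrow> dist y0 y < \<delta> \<Longrightarrow> y \<in> T n" by auto
  define C where "C = 2 * real n / \<delta>"
  \<comment> \<open>Vectors of the range near \<open>y0\<close> have approximate preimages of norm at most \<open>n\<close>. This is moved
    to the origin and rescaled, with the relative error \<open>1 / 2\<close> that makes the series below converge.\<close>
  have approx: "\<exists>x\<in>V. norm x \<le> C * norm y \<and> norm (y - d x) \<le> norm y / 2" if y: "y \<in> d ` V" for y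
  proof (cases "y = 0")
    case True
    then show ?thesis using V0 d0 by (intro bexI[of _ 0]) auto
  next
    case False
    \<comment> \<open>Rescale \<open>y\<close> to a vector \<open>z\<close> of norm \<open>\<delta> / 2\<close>. Half the difference of approximate preimages
      of \<open>y0 + z\<close> and \<open>y0 - z\<close> is one of \<open>z\<close>, in which \<open>y0\<close> has cancelled.\<close>
    define r where "r = \<delta> / (2 * norm y)"
    define z where "z = r *\<^sub>R y"
    have r: "r > 0" using False \<delta>(1) by (simp add: r_def)
    have nz: "norm z = \<delta> / 2" using False \<delta>(1) by (simp add: z_def r_def)
    have z: "z \<in> d ` V" using sub y by (simp add: z_def subspace_scale)
    have "\<exists>x\<in>V. norm x \<le> real n \<and> norm (d x - w) < \<delta> / 4" if "w \<in> T n" for w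
      using that \<delta>(1) unfolding T_def closure_approachable dist_norm
      by (elim allE[of _ "\<delta> / 4"]) auto
    moreover have "y0 + z \<in> T n" "y0 - z \<in> T n"
      using \<delta> nz sub y0 z by (auto simp: dist_norm subspace_add subspace_diff intro!: \<delta>(2))
    ultimately obtain x1 x2 where x1: "x1 \<in> V" "norm x1 \<le> real n" "norm (d x1 - (y0 + z)) < \<delta> / 4"
      and x2: "x2 \<in> V" "norm x2 \<le> real n" "norm (d x2 - (y0 - z)) < \<delta> / 4"
      by metis
    define x where "x = (1 / (2 * r)) *\<^sub>R (x1 - x2)"
    have xV: "x \<in> V" using V x1 x2 by (simp add: x_def subspace_diff subspace_scale)
    have "d x = (1 / (2 * r)) *\<^sub>R (d x1 - d x2)"
      using V x1 x2 by (simp add: x_def scale subspace_diff diff)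
    moreover have "y = (1 / (2 * r)) *\<^sub>R (2 *\<^sub>R z)" using r by (simp add: z_def)
    ultimately have "y - d x = (1 / (2 * r)) *\<^sub>R (2 *\<^sub>R z - (d x1 - d x2))"
      by (metis scaleR_right_diff_distrib)
    also have "2 *\<^sub>R z - (d x1 - d x2) = (d x2 - (y0 - z)) - (d x1 - (y0 + z))"
      by (simp add: scaleR_2)
    finally have "norm (y - d x) = (1 / (2 * r)) * norm ((d x2 - (y0 - z)) - (d x1 - (y0 + z)))"
      using r by simp
    also have "\<dots> \<le> (1 / (2 * r)) * (\<delta> / 2)"
      using r x1(3) x2(3) norm_triangle_ineq4[of "d x2 - (y0 - z)" "d x1 - (y0 + z)"]
      by (intro mult_left_mono) auto
    also have "\<dots> = norm y / 2" using \<delta>(1) False by (simp add: r_def)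
    finally have "norm (y - d x) \<le> norm y / 2" .
    moreover have "norm x \<le> C * norm y"
    proof -
      have "norm x = (1 / (2 * r)) * norm (x1 - x2)" using r by (simp add: x_def)
      also have "\<dots> \<le> (1 / (2 * r)) * (2 * real n)"
        using r x1(2) x2(2) norm_triangle_ineq4[of x1 x2] by (intro mult_left_mono) auto
      also have "\<dots> = C * norm y" using False \<delta>(1) by (simp add: r_def C_def field_simps)
      finally show ?thesis .
    qed
    ultimately show ?thesis using xV by blast
  qed
  then obtain f where f: "\<And>y. y \<in> d ` V \<Longrightarrow> f y \<in> V" "\<And>y. y \<in> d ` V \<Longrightarrow> norm (f y) \<le> C * norm y"
    "\<And>y. y \<in> d ` V \<Longrightarrow> norm (y - d (f y)) \<le> norm y / 2" by metis
  have "\<exists>x\<in>V. d x = y \<and> norm x \<le> 2 * C * norm y" if y: "y \<in> d ` V" for y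
  proof -
    \<comment> \<open>\<open>r k\<close> is the residual after \<open>k\<close> corrections.\<close>
    define r where "r k = ((\<lambda>z. z - d (f z)) ^^ k) y" for k
    have r0: "r 0 = y" and rS: "r (Suc k) = r k - d (f (r k))" for k by (simp_all add: r_def)
    have rR: "r k \<in> d ` V" for k
      by (induction k) (use y sub f(1) in \<open>auto simp: r0 rS subspace_diff\<close>)
    have nr: "norm (r k) \<le> norm y * (1 / 2) ^ k" for k
    proof (induction k)
      case (Suc k)
      show ?case using Suc f(3)[OF rR[of k]] by (simp add: rS)
    qed (simp add: r0)
    have C0: "C \<ge> 0" using \<delta>(1) by (simp add: C_def)
    have nf: "norm (f (r k)) \<le> C * norm y * (1 / 2) ^ k" for k
      using f(2)[OF rR[of k]] mult_left_mono[OF nr[of k] C0] by (simp add: mult.assoc)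
    have geo: "(\<lambda>k. C * norm y * (1 / 2) ^ k) sums (C * norm y * 2)"
      using sums_mult[OF geometric_sums[of "1 / 2 :: real"], of "C * norm y"] by simp
    have smb: "summable (\<lambda>k. f (r k))"
      using summable_comparison_test'[OF sums_summable[OF geo], of 0 "\<lambda>k. f (r k)"] nf by blast
    define x where "x = (\<Sum>k. f (r k))"
    have lim: "(\<lambda>m. \<Sum>k<m. f (r k)) \<longlonglongrightarrow> x"
      unfolding x_def using smb by (simp add: summable_LIMSEQ)
    have part: "(\<Sum>k<m. f (r k)) \<in> V \<and> d (\<Sum>k<m. f (r k)) = y - r m" for m
      by (induction m) (use V V0 d0 f(1)[OF rR] in \<open>auto simp: r0 rS add subspace_add\<close>)
    have "(\<lambda>m. norm y * (1 / 2) ^ m) \<longlonglongrightarrow> norm y * 0"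
      by (intro tendsto_mult_left LIMSEQ_realpow_zero) auto
    then have "r \<longlonglongrightarrow> 0" by (intro Lim_null_comparison[of r]) (use nr in auto)
    then have "(\<lambda>m. d (\<Sum>k<m. f (r k))) \<longlonglongrightarrow> y - 0"
      unfolding conjunct2[OF part] by (intro tendsto_intros)
    then have pair: "(\<lambda>m. (\<Sum>k<m. f (r k), d (\<Sum>k<m. f (r k)))) \<longlonglongrightarrow> (x, y)"
      using lim by (simp add: tendsto_Pair)
    have "(x, y) \<in> (\<lambda>x. (x, d x)) ` V"
      by (rule closed_sequentially[OF graph _ pair]) (use part in blast)
    moreover have "norm x \<le> 2 * C * norm y"
    proof -
      have "norm x \<le> (\<Sum>k. C * norm y * (1 / 2) ^ k)"
        unfolding x_def
        by (rule norm_suminf_le[OF nf sums_summable[OF geo]])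
      also have "\<dots> = 2 * C * norm y" using sums_unique[OF geo] by simp
      finally show ?thesis .
    qed
    ultimately show ?thesis by auto
  qed
  then show thesis using that by blast
qed

text \<open>
  Among the preimages of \<open>y\<close> the one orthogonal to the kernel depends linearly on \<open>y\<close> and is the
  shortest; the bound on some preimage is therefore a bound on it. Composing with the projection onto
  the range makes \<open>S\<close> a bounded operator on the whole space, so that it maps derivatives to derivatives.
\<close>

lemma bounded_pseudo_inverse_exists:
  fixes d :: "'a::{real_inner,banach} \<Rightarrow> 'b::{real_inner,banach}"
  assumes d: "closed_densely_defined_op V d" and closed_range: "closed (d ` V)"
  obtains S where "bounded_linear S" "\<And>y. y \<in> d ` V \<Longrightarrow> S y \<in> V" "\<And>y. y \<in> d ` V \<Longrightarrow> d (S y) = y"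
    "\<And>x. x \<in> V \<Longrightarrow> norm (S (d x)) \<le> norm x"
proof -
  have V: "subspace V" and add: "\<And>x y. x \<in> V \<Longrightarrow> y \<in> V \<Longrightarrow> d (x + y) = d x + d y"
    using d by (auto simp: closed_densely_defined_op_def)
  note diff = closed_densely_defined_op_diff[OF d]
    and scale = closed_densely_defined_op_scaleR[OF d]
  obtain P where P: "bounded_linear P" and PK: "\<And>x. P x \<in> {x \<in> V. d x = 0}"
    and "\<And>x k. k \<in> {x \<in> V. d x = 0} \<Longrightarrow> inner (x - P x) k = 0"
    and Pid: "\<And>k. k \<in> {x \<in> V. d x = 0} \<Longrightarrow> P k = k" and Pn: "\<And>x. norm (x - P x) \<le> norm x"
    by (fact orthogonal_projection_exists[OF closed_kernel[OF d]])
  interpret P: bounded_linear P by (rule P)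
  obtain Q where Q: "bounded_linear Q" and QR: "\<And>y. Q y \<in> d ` V"
    and "\<And>x k. k \<in> d ` V \<Longrightarrow> inner (x - Q x) k = 0"
    and Qid: "\<And>y. y \<in> d ` V \<Longrightarrow> Q y = y" and "\<And>x. norm (x - Q x) \<le> norm x"
    by (fact orthogonal_projection_exists[OF subspace_range[OF d] closed_range])
  interpret Q: bounded_linear Q by (rule Q)
  obtain C where C: "\<And>y. y \<in> d ` V \<Longrightarrow> \<exists>x\<in>V. d x = y \<and> norm x \<le> C * norm y"
    using closed_range_bounded_preimages[OF d closed_range] by blast
  obtain g where g: "\<And>y. y \<in> d ` V \<Longrightarrow> g y \<in> V" "\<And>y. y \<in> d ` V \<Longrightarrow> d (g y) = y"
    and gn: "\<And>y. y \<in> d ` V \<Longrightarrow> norm (g y) \<le> C * norm y" using C by metis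
  define S where "S y = g (Q y) - P (g (Q y))" for y
  have gQ: "g (Q y) \<in> V" "d (g (Q y)) = Q y" for y using g QR by auto
  \<comment> \<open>Two preimages differ by an element of the kernel, on which \<open>P\<close> is the identity, so all of
    them give the same value.\<close>
  have S_eq: "S y = x - P x" if x: "x \<in> V" "d x = Q y" for x y
  proof -
    have "g (Q y) - x \<in> {x \<in> V. d x = 0}"
      using x gQ V by (simp add: diff subspace_diff)
    then have "P (g (Q y) - x) = g (Q y) - x" by (rule Pid)
    then show ?thesis by (simp add: S_def P.diff algebra_simps)
  qed
  obtain N where N: "\<And>y. norm (Q y) \<le> norm y * N" "N \<ge> 0" using Q.nonneg_bounded by metis
  have "bounded_linear S"
  proof (rule bounded_linear_intro[where K = "\<bar>C\<bar> * N"])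
    show "S (x + y) = S x + S y" for x y
    proof -
      have "S (x + y) = g (Q x) + g (Q y) - P (g (Q x) + g (Q y))"
        using gQ V by (intro S_eq) (auto simp: add subspace_add Q.add)
      then show ?thesis by (simp add: S_def P.add)
    qed
    show "S (r *\<^sub>R x) = r *\<^sub>R S x" for r x
    proof -
      have "S (r *\<^sub>R x) = r *\<^sub>R g (Q x) - P (r *\<^sub>R g (Q x))"
        using gQ V by (intro S_eq) (auto simp: scale subspace_scale Q.scaleR)
      then show ?thesis by (simp add: S_def P.scaleR scaleR_right_diff_distrib)
    qed
    show "norm (S x) \<le> norm x * (\<bar>C\<bar> * N)" for x
    proof -
      have "norm (S x) \<le> norm (g (Q x))" unfolding S_def by (rule Pn)
      also have "\<dots> \<le> C * norm (Q x)" by (rule gn[OF QR])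
      also have "\<dots> \<le> \<bar>C\<bar> * norm (Q x)" by (intro mult_right_mono) auto
      also have "\<dots> \<le> \<bar>C\<bar> * (norm x * N)" by (intro mult_left_mono N) auto
      finally show ?thesis by (simp add: mult_ac)
    qed
  qed
  moreover have "S y \<in> V" for y unfolding S_def using V gQ PK by (intro subspace_diff) auto
  moreover have "d (S y) = y" if "y \<in> d ` V" for y
    using gQ[of y] PK[of "g (Q y)"] Qid[OF that] by (simp add: S_def diff)
  moreover have "norm (S (d x)) \<le> norm x" if "x \<in> V" for x
    using S_eq[of x "d x"] Qid[of "d x"] that Pn by simp
  ultimately show thesis using that by blast
qed

section \<open>Decay of differentiable solutions\<close>

lemma has_real_derivative_inner:
  assumes "(f has_vector_derivative f') (at x)" "(g has_vector_derivative g') (at x)"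
  shows "((\<lambda>x. inner (f x) (g x)) has_real_derivative (inner (f x) g' + inner f' (g x))) (at x)"
  using bounded_bilinear.has_vector_derivative[OF bounded_bilinear_inner assms]
  by (simp add: has_real_derivative_iff_has_vector_derivative)

text \<open>
  Gronwall's inequality for \<open>F\<close>, transferred to the equivalent quantity \<open>E\<close>. The constant \<open>3\<close> is the
  quotient of the two equivalence constants \<open>3 / 2\<close> and \<open>1 / 2\<close>.
\<close>

lemma lyapunov_decay:
  fixes E F F' :: "real \<Rightarrow> real"
  assumes cont: "continuous_on {0..} F"
    and F: "\<And>t. t > 0 \<Longrightarrow> (F has_real_derivative F' t) (at t)"
    and F': "\<And>t. t > 0 \<Longrightarrow> F' t \<le> - c * F t"
    and E: "\<And>t. t \<ge> 0 \<Longrightarrow> E t / 2 \<le> F t" "\<And>t. t \<ge> 0 \<Longrightarrow> F t \<le> 3 / 2 * E t"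
    and st: "0 \<le> s" "s \<le> t"
  shows "E t \<le> 3 * exp (- c * (t - s)) * E s"
proof -
  have "exp (c * t) * F t \<le> exp (c * s) * F s"
  proof (rule DERIV_nonpos_imp_decreasing_open[OF st(2)])
    fix r assume "s < r" "r < t"
    then have r: "r > 0" using st by simp
    have "((\<lambda>r. exp (c * r) * F r) has_real_derivative
        (exp (c * r) * F' r + exp (c * r) * c * F r)) (at r)"
      by (auto intro!: derivative_eq_intros F[OF r])
    moreover have "exp (c * r) * F' r + exp (c * r) * c * F r = exp (c * r) * (F' r + c * F r)"
      by (simp add: algebra_simps)
    moreover have "exp (c * r) * (F' r + c * F r) \<le> 0"
      using F'[OF r] by (intro mult_nonneg_nonpos) auto
    ultimately show "\<exists>y. ((\<lambda>r. exp (c * r) * F r) has_real_derivative y) (at r) \<and> y \<le> 0" by auto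
  next
    show "continuous_on {s..t} (\<lambda>r. exp (c * r) * F r)"
      using st by (intro continuous_intros continuous_on_subset[OF cont]) auto
  qed
  then have "exp (- c * t) * (exp (c * t) * F t) \<le> exp (- c * t) * (exp (c * s) * F s)"
    by (intro mult_left_mono) auto
  moreover have "exp (- c * t) * (exp (c * t) * F t) = F t" by (simp add: exp_minus)
  moreover have "exp (- c * (t - s)) = exp (- c * t) * exp (c * s)"
    unfolding exp_add[symmetric] by (simp add: right_diff_distrib)
  ultimately have "F t \<le> exp (- c * (t - s)) * F s" by (simp only: mult.assoc)
  also have "\<dots> \<le> exp (- c * (t - s)) * (3 / 2 * E s)"
    using E(2) st by (intro mult_left_mono) auto
  finally show ?thesis using E(1)[of t] st by simp
qed

text \<open>
  The functional of \<open>lyapunov_decay\<close> is the energy minus \<open>\<epsilon>\<close> times the cross term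
  \<open>\<langle>\<alpha> u, S (\<gamma> v)\<rangle>\<close>, whose derivative supplies the dissipation of \<open>v\<close>. Asking for the
  equations at \<open>t > 0\<close> and for continuity at \<open>0\<close> avoids one-sided derivatives.
\<close>

lemma strict_solution_decay:
  fixes d :: "'a::{real_inner,banach} \<Rightarrow> 'b::{real_inner,banach}"
  assumes d: "closed_densely_defined_op V d" and closed_range: "closed (d ` V)"
    and \<alpha>: "selfadjoint_positive_iso \<alpha>"
    and \<beta>: "selfadjoint_positive_iso \<beta>"
    and \<gamma>: "selfadjoint_positive_iso \<gamma>"
  obtains c where "c > 0"
    "\<And>u u' v v' s t.
      \<lbrakk>continuous_on {0..} u; continuous_on {0..} v;
       \<And>t. t > 0 \<Longrightarrow> (u has_vector_derivative u' t) (at t);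
       \<And>t. t > 0 \<Longrightarrow> (v has_vector_derivative v' t) (at t);
       \<And>t. t > 0 \<Longrightarrow> u t \<in> V; \<And>t. t > 0 \<Longrightarrow> v t \<in> adjoint_dom V d;
       \<And>t. t > 0 \<Longrightarrow> \<alpha> (u' t) = adjoint_op V d (v t) - \<beta> (u t);
       \<And>t. t > 0 \<Longrightarrow> \<gamma> (v' t) = - d (u t);
       \<And>t. t > 0 \<Longrightarrow> \<gamma> (v t) \<in> d ` V; 0 \<le> s; s \<le> t\<rbrakk> \<Longrightarrow>
      inner (\<alpha> (u t)) (u t) + inner (\<gamma> (v t)) (v t)
        \<le> 3 * exp (- c * (t - s)) * (inner (\<alpha> (u s)) (u s) + inner (\<gamma> (v s)) (v s))"
proof -
  obtain S where S: "bounded_linear S" "\<And>y. y \<in> d ` V \<Longrightarrow> S y \<in> V" "\<And>y. y \<in> d ` V \<Longrightarrow> d (S y) = y"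
    and Sd: "\<And>x. x \<in> V \<Longrightarrow> norm (S (d x)) \<le> norm x"
    using bounded_pseudo_inverse_exists[OF d closed_range] by metis
  have lin: "bounded_linear \<alpha>" "bounded_linear \<beta>" "bounded_linear \<gamma>"
    and sym: "\<And>x y. inner (\<alpha> x) y = inner x (\<alpha> y)" "\<And>x y. inner (\<gamma> x) y = inner x (\<gamma> y)"
    using \<alpha> \<beta> \<gamma> by (simp_all add: selfadjoint_positive_iso_def)
  interpret \<alpha>: bounded_linear \<alpha> by (rule lin)
  interpret \<beta>: bounded_linear \<beta> by (rule lin)
  interpret \<gamma>: bounded_linear \<gamma> by (rule lin)
  interpret S: bounded_linear S by (rule S)
  obtain a where a: "a > 0" "\<And>x. a * (norm x)\<^sup>2 \<le> inner (\<alpha> x) x"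
    using selfadjoint_positive_iso_coercive[OF \<alpha>] by blast
  obtain b where b: "b > 0" "\<And>x. b * (norm x)\<^sup>2 \<le> inner (\<beta> x) x"
    using selfadjoint_positive_iso_coercive[OF \<beta>] by blast
  obtain g where g: "g > 0" "\<And>x. g * (norm x)\<^sup>2 \<le> inner (\<gamma> x) x"
    using selfadjoint_positive_iso_coercive[OF \<gamma>] by blast
  obtain A where A: "A > 0" "\<And>x. norm (\<alpha> x) \<le> norm x * A" using \<alpha>.pos_bounded by auto
  obtain B where B: "B > 0" "\<And>x. norm (\<beta> x) \<le> norm x * B" using \<beta>.pos_bounded by auto
  obtain G where G: "G > 0" "\<And>x. norm (\<gamma> x) \<le> norm x * G" using \<gamma>.pos_bounded by auto
  obtain M where M: "M > 0" "\<And>x. norm (S (\<gamma> x)) \<le> norm x * M"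
    using bounded_linear.pos_bounded[OF bounded_linear_compose[OF S(1) lin(3)]] by auto
  have inner_le: "\<bar>inner x y\<bar> \<le> p * q" if "norm x \<le> p" "norm y \<le> q" for x y :: 'a and p q
    using Cauchy_Schwarz_ineq2[of x y] mult_mono[OF that] order_trans[OF norm_ge_zero that(1)]
    by fastforce
  \<comment> \<open>The first bound on \<open>\<epsilon>\<close> keeps half of the dissipation of \<open>u\<close> after the errors from the
    cross term have been absorbed; the second makes \<open>F\<close> below equivalent to the energy.\<close>
  define \<epsilon> where "\<epsilon> = min (b / (A + (B * M)\<^sup>2 / (2 * g))) (min a g / (A * M))"
  have den: "A + (B * M)\<^sup>2 / (2 * g) > 0" using A(1) g(1) by (simp add: add_pos_nonneg)
  have AM: "A * M > 0" using A M by simp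
  have \<epsilon>: "\<epsilon> > 0" "\<epsilon> * (A + (B * M)\<^sup>2 / (2 * g)) \<le> b" "\<epsilon> * (A * M) \<le> a" "\<epsilon> * (A * M) \<le> g"
  proof -
    show "\<epsilon> > 0" using a(1) b(1) g(1) den AM by (simp add: \<epsilon>_def)
    have "\<epsilon> \<le> b / (A + (B * M)\<^sup>2 / (2 * g))" by (simp add: \<epsilon>_def)
    then show "\<epsilon> * (A + (B * M)\<^sup>2 / (2 * g)) \<le> b" using den by (simp add: pos_le_divide_eq)
    have "\<epsilon> \<le> min a g / (A * M)" by (simp add: \<epsilon>_def)
    then have "\<epsilon> * (A * M) \<le> min a g" using AM by (simp add: pos_le_divide_eq)
    then show "\<epsilon> * (A * M) \<le> a" "\<epsilon> * (A * M) \<le> g" by auto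
  qed
  \<comment> \<open>The derivative of \<open>F\<close> turns out to be at most \<open>- min b (\<epsilon> * g / 2)\<close> times the squared norm of
    the state, and \<open>F\<close> is at most \<open>3 / 2 * (A + G)\<close> times that squared norm.\<close>
  define c where "c = min b (\<epsilon> * g / 2) / (3 / 2 * (A + G))"
  have c: "c > 0" using a b g A G \<epsilon> by (simp add: c_def)
  define E where "E x y = inner (\<alpha> x) x + inner (\<gamma> y) y" for x y
  define F where "F x y = E x y - \<epsilon> * inner (\<alpha> x) (S (\<gamma> y))" for x y
  have cross: "\<bar>\<epsilon> * inner (\<alpha> x) (S (\<gamma> y))\<bar> \<le> E x y / 2" for x y
  proof -
    have "\<bar>inner (\<alpha> x) (S (\<gamma> y))\<bar> \<le> (norm x * A) * (norm y * M)" by (rule inner_le[OF A(2) M(2)])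
    then have "\<bar>\<epsilon> * inner (\<alpha> x) (S (\<gamma> y))\<bar> \<le> \<epsilon> * ((norm x * A) * (norm y * M))"
      using \<epsilon>(1) by (simp add: abs_mult)
    also have "\<dots> = (\<epsilon> * (A * M)) * (norm x * norm y)" by simp
    also have "\<dots> \<le> (\<epsilon> * (A * M)) * (((norm x)\<^sup>2 + (norm y)\<^sup>2) / 2)"
      using \<epsilon>(1) AM sum_squares_bound[of "norm x" "norm y"] by (intro mult_left_mono) auto
    also have "\<dots> \<le> (a * (norm x)\<^sup>2 + g * (norm y)\<^sup>2) / 2"
      using mult_right_mono[OF \<epsilon>(3), of "(norm x)\<^sup>2"] mult_right_mono[OF \<epsilon>(4), of "(norm y)\<^sup>2"]
      by (simp add: algebra_simps)
    also have "\<dots> \<le> E x y / 2" using a(2)[of x] g(2)[of y] by (simp add: E_def)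
    finally show ?thesis .
  qed
  have FE: "E x y / 2 \<le> F x y" "F x y \<le> 3 / 2 * E x y" for x y
    using cross[of x y] by (auto simp: F_def abs_le_iff)
  have E_le: "E x y \<le> (A + G) * ((norm x)\<^sup>2 + (norm y)\<^sup>2)" for x y
  proof -
    have "inner (\<alpha> x) x \<le> norm (\<alpha> x) * norm x" by (rule norm_cauchy_schwarz)
    also have "\<dots> \<le> A * (norm x)\<^sup>2"
      using mult_right_mono[OF A(2)[of x], of "norm x"] by (simp add: power2_eq_square mult_ac)
    finally have 1: "inner (\<alpha> x) x \<le> A * (norm x)\<^sup>2" .
    have "inner (\<gamma> y) y \<le> norm (\<gamma> y) * norm y" by (rule norm_cauchy_schwarz)
    also have "\<dots> \<le> G * (norm y)\<^sup>2"
      using mult_right_mono[OF G(2)[of y], of "norm y"] by (simp add: power2_eq_square mult_ac)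
    finally have "inner (\<gamma> y) y \<le> G * (norm y)\<^sup>2" .
    moreover have "0 \<le> G * (norm x)\<^sup>2" "0 \<le> A * (norm y)\<^sup>2" using A(1) G(1) by auto
    ultimately show ?thesis using 1 by (simp add: E_def algebra_simps)
  qed
  have rate: "- 2 * inner (\<beta> x) x - \<epsilon> * (inner (\<gamma> y) y - inner (\<beta> x) (S (\<gamma> y)) - inner (\<alpha> x) (S (d x)))
      \<le> - c * F x y" if "x \<in> V" for x y
  proof -
    let ?p = "norm x" and ?q = "norm y"
    have "\<bar>inner (\<beta> x) (S (\<gamma> y))\<bar> \<le> (?p * B) * (?q * M)" by (rule inner_le[OF B(2) M(2)])
    moreover have "(?p * B) * (?q * M) \<le> g / 2 * ?q\<^sup>2 + (B * M)\<^sup>2 / (2 * g) * ?p\<^sup>2"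
    proof -
      have "0 \<le> (g * ?q - B * M * ?p)\<^sup>2 / (2 * g)" using g(1) by simp
      also have "\<dots> = g / 2 * ?q\<^sup>2 + (B * M)\<^sup>2 / (2 * g) * ?p\<^sup>2 - (?p * B) * (?q * M)"
        using g(1) by (simp add: power2_eq_square field_simps)
      finally show ?thesis by simp
    qed
    moreover have "\<bar>inner (\<alpha> x) (S (d x))\<bar> \<le> (?p * A) * ?p"
      by (rule inner_le[OF A(2) Sd[OF that]])
    ultimately have "inner (\<gamma> y) y - inner (\<beta> x) (S (\<gamma> y)) - inner (\<alpha> x) (S (d x))
        \<ge> g / 2 * ?q\<^sup>2 - (A + (B * M)\<^sup>2 / (2 * g)) * ?p\<^sup>2"
      using g(2)[of y] by (simp add: power2_eq_square algebra_simps abs_le_iff)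
    from mult_left_mono[OF this less_imp_le[OF \<epsilon>(1)]]
    have "\<epsilon> * (inner (\<gamma> y) y - inner (\<beta> x) (S (\<gamma> y)) - inner (\<alpha> x) (S (d x)))
        \<ge> (\<epsilon> * g / 2) * ?q\<^sup>2 - (\<epsilon> * (A + (B * M)\<^sup>2 / (2 * g))) * ?p\<^sup>2"
      by (simp add: algebra_simps)
    moreover have "(\<epsilon> * (A + (B * M)\<^sup>2 / (2 * g))) * ?p\<^sup>2 \<le> b * ?p\<^sup>2"
      using \<epsilon>(2) by (intro mult_right_mono) auto
    moreover have "min b (\<epsilon> * g / 2) * ?p\<^sup>2 \<le> b * ?p\<^sup>2"
      "min b (\<epsilon> * g / 2) * ?q\<^sup>2 \<le> (\<epsilon> * g / 2) * ?q\<^sup>2"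
      by (intro mult_right_mono; simp)+
    moreover have "c * F x y \<le> min b (\<epsilon> * g / 2) * ?p\<^sup>2 + min b (\<epsilon> * g / 2) * ?q\<^sup>2"
    proof -
      have "c * F x y \<le> c * (3 / 2 * ((A + G) * (?p\<^sup>2 + ?q\<^sup>2)))"
        using c FE(2)[of x y] E_le[of x y] by (intro mult_left_mono) auto
      also have "\<dots> = (c * (3 / 2 * (A + G))) * (?p\<^sup>2 + ?q\<^sup>2)" by (simp only: mult.assoc)
      also have "c * (3 / 2 * (A + G)) = min b (\<epsilon> * g / 2)" using A(1) G(1) by (simp add: c_def)
      finally show ?thesis by (simp add: distrib_left)
    qed
    moreover note b(2)[of x]
    ultimately show ?thesis by linarith
  qed
  show thesis
  proof (rule that[OF c])
    fix u u' v v' and s t :: real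
    assume cont: "continuous_on {0..} u" "continuous_on {0..} v"
      and der: "\<And>t. t > 0 \<Longrightarrow> (u has_vector_derivative u' t) (at t)"
        "\<And>t. t > 0 \<Longrightarrow> (v has_vector_derivative v' t) (at t)"
      and dom: "\<And>t. t > 0 \<Longrightarrow> u t \<in> V" "\<And>t. t > 0 \<Longrightarrow> v t \<in> adjoint_dom V d"
      and eq: "\<And>t. t > 0 \<Longrightarrow> \<alpha> (u' t) = adjoint_op V d (v t) - \<beta> (u t)"
        "\<And>t. t > 0 \<Longrightarrow> \<gamma> (v' t) = - d (u t)"
      and range: "\<And>t. t > 0 \<Longrightarrow> \<gamma> (v t) \<in> d ` V" and st: "0 \<le> s" "s \<le> t"
    have "E (u t) (v t) \<le> 3 * exp (- c * (t - s)) * E (u s) (v s)"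
    proof (rule lyapunov_decay[where E = "\<lambda>t. E (u t) (v t)" and F = "\<lambda>t. F (u t) (v t)" and F' = "\<lambda>t. - 2 * inner (\<beta> (u t)) (u t)
        - \<epsilon> * (inner (\<gamma> (v t)) (v t) - inner (\<beta> (u t)) (S (\<gamma> (v t))) - inner (\<alpha> (u t)) (S (d (u t))))"])
      show "continuous_on {0..} (\<lambda>t. F (u t) (v t))"
        unfolding F_def E_def
        by (intro continuous_intros cont \<alpha>.continuous_on \<gamma>.continuous_on S.continuous_on)
      fix r :: real assume r: "r > 0"
      note ders = der[OF r] \<alpha>.has_vector_derivative[OF der(1)[OF r]]
        \<gamma>.has_vector_derivative[OF der(2)[OF r]]
        S.has_vector_derivative[OF \<gamma>.has_vector_derivative[OF der(2)[OF r]]]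
      have adj: "inner (adjoint_op V d (v r)) x = inner (v r) (d x)" if "x \<in> V" for x
        using inner_adjoint_op[OF d dom(2)[OF r] that] .
      \<comment> \<open>The contributions of \<open>d\<close> and of its adjoint to the energy balance cancel.\<close>
      have E': "inner (\<alpha> (u r)) (u' r) + inner (\<alpha> (u' r)) (u r)
          + (inner (\<gamma> (v r)) (v' r) + inner (\<gamma> (v' r)) (v r)) = - 2 * inner (\<beta> (u r)) (u r)"
        using adj[OF dom(1)[OF r]] sym(1)[of "u r" "u' r"] sym(2)[of "v r" "v' r"] eq[OF r]
        by (simp add: inner_diff_left inner_diff_right inner_commute)
      have "inner (\<alpha> (u' r)) (S (\<gamma> (v r))) = inner (v r) (\<gamma> (v r)) - inner (\<beta> (u r)) (S (\<gamma> (v r)))"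
        using adj[OF S(2)[OF range[OF r]]] S(3)[OF range[OF r]] eq(1)[OF r]
        by (simp add: inner_diff_left)
      then have G': "inner (\<alpha> (u r)) (S (\<gamma> (v' r))) + inner (\<alpha> (u' r)) (S (\<gamma> (v r)))
          = inner (\<gamma> (v r)) (v r) - inner (\<beta> (u r)) (S (\<gamma> (v r))) - inner (\<alpha> (u r)) (S (d (u r)))"
        by (simp add: eq(2)[OF r] linear_neg[OF S.linear] inner_commute)
      show "((\<lambda>t. F (u t) (v t)) has_real_derivative - 2 * inner (\<beta> (u r)) (u r)
        - \<epsilon> * (inner (\<gamma> (v r)) (v r) - inner (\<beta> (u r)) (S (\<gamma> (v r))) - inner (\<alpha> (u r)) (S (d (u r))))) (at r)"
        unfolding F_def E_def E'[symmetric] G'[symmetric]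
        by (intro DERIV_diff DERIV_add DERIV_cmult has_real_derivative_inner ders)
      show "- 2 * inner (\<beta> (u r)) (u r)
        - \<epsilon> * (inner (\<gamma> (v r)) (v r) - inner (\<beta> (u r)) (S (\<gamma> (v r))) - inner (\<alpha> (u r)) (S (d (u r))))
        \<le> - c * F (u r) (v r)" by (rule rate[OF dom(1)[OF r]])
    qed (rule FE st)+
    then show "inner (\<alpha> (u t)) (u t) + inner (\<gamma> (v t)) (v t)
        \<le> 3 * exp (- c * (t - s)) * (inner (\<alpha> (u s)) (u s) + inner (\<gamma> (v s)) (v s))"
      by (simp only: E_def)
  qed
qed

section \<open>Decay of mild solutions\<close>

lemma adjoint_op_eqI:
  fixes d :: "'a::{real_inner,banach} \<Rightarrow> 'b::{real_inner,banach}"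
  assumes d: "closed_densely_defined_op V d" and w: "\<And>u. u \<in> V \<Longrightarrow> inner w u = inner v (d u)"
  shows "v \<in> adjoint_dom V d" "adjoint_op V d v = w"
proof -
  show dom: "v \<in> adjoint_dom V d" using w by (auto simp: adjoint_dom_def)
  show "adjoint_op V d v = w"
    using d w inner_adjoint_op[OF d dom]
    by (intro adjoint_op_unique[of V _ v d]) (auto simp: closed_densely_defined_op_def)
qed

lemma adjoint_op_scaleR_diff:
  fixes d :: "'a::{real_inner,banach} \<Rightarrow> 'b::{real_inner,banach}"
  assumes d: "closed_densely_defined_op V d" and v: "v \<in> adjoint_dom V d" and w: "w \<in> adjoint_dom V d"
  shows "r *\<^sub>R (v - w) \<in> adjoint_dom V d"
    "adjoint_op V d (r *\<^sub>R (v - w)) = r *\<^sub>R (adjoint_op V d v - adjoint_op V d w)"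
  by (rule adjoint_op_eqI[OF d, where w = "r *\<^sub>R (adjoint_op V d v - adjoint_op V d w)"],
      simp add: inner_diff_left inner_adjoint_op[OF d v] inner_adjoint_op[OF d w])+

lemma integral_has_vector_derivative_atLeast:
  fixes x :: "real \<Rightarrow> 'x::banach"
  assumes "continuous_on {a..} x" "t \<ge> a"
  shows "((\<lambda>t. integral {a..t} x) has_vector_derivative x t) (at t within {a..})"
proof -
  have "((\<lambda>t. integral {a..t} x) has_vector_derivative x t) (at t within {a..t + 1})"
    using assms by (intro integral_has_vector_derivative continuous_on_subset[OF assms(1)]) auto
  also have "at t within {a..t + 1} = at t within {a..}"
    by (rule at_within_nhd[of t "{..<t + 1}"]) auto
  finally show ?thesis .
qed

lemma has_vector_derivative_imp_difference_quotients:
  assumes "(X has_vector_derivative x) (at t within {a..})" "t \<ge> a"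
  shows "(\<lambda>n. real (Suc n) *\<^sub>R (X (t + 1 / real (Suc n)) - X t)) \<longlonglongrightarrow> x"
proof -
  define y where "y n = t + 1 / real (Suc n)" for n
  have lim: "y \<longlonglongrightarrow> t + 0"
    unfolding y_def by (intro tendsto_intros lim_1_over_n[THEN LIMSEQ_Suc])
  have "y n \<in> {a..}" "y n \<noteq> t" for n
    using assms(2) add_increasing2[of "1 / real (Suc n)" a t] by (auto simp: y_def)
  then have "filterlim y (at t within {a..}) sequentially"
    unfolding filterlim_at using lim by simp
  moreover have "((\<lambda>z. (1 / norm (z - t)) *\<^sub>R (X z - (X t + (z - t) *\<^sub>R x))) \<longlongrightarrow> 0) (at t within {a..})"
    using assms(1) unfolding has_vector_derivative_def has_derivative_within by blast
  ultimately have "(\<lambda>n. (1 / norm (y n - t)) *\<^sub>R (X (y n) - (X t + (y n - t) *\<^sub>R x))) \<longlonglongrightarrow> 0"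
    by (rule filterlim_compose[rotated])
  moreover have "(1 / norm (y n - t)) *\<^sub>R (X (y n) - (X t + (y n - t) *\<^sub>R x))
      = real (Suc n) *\<^sub>R (X (t + 1 / real (Suc n)) - X t) - x" for n
    by (simp add: y_def scaleR_right_diff_distrib scaleR_add_right diff_diff_eq)
  ultimately show ?thesis by (simp only: LIM_zero_iff)
qed

text \<open>
  If \<open>(U, Q)\<close> is the integral of the solution from \<open>0\<close>, then the difference quotients of \<open>U\<close> and \<open>Q\<close> with
  step \<open>h\<close> lie in the domain and satisfy the system pointwise: the initial values in the integrated
  equations cancel. The compatibility condition passes from \<open>\<gamma> v(0)\<close> first to all \<open>\<gamma> v(t)\<close> and then, by
  integration, to the averages.
\<close>

lemma mild_solution_decay:
  fixes d :: "'a::{real_inner,banach} \<Rightarrow> 'b::{real_inner,banach}"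
  assumes d: "closed_densely_defined_op V d" and closed_range: "closed (d ` V)"
    and \<alpha>: "selfadjoint_positive_iso \<alpha>"
    and \<beta>: "selfadjoint_positive_iso \<beta>"
    and \<gamma>: "selfadjoint_positive_iso \<gamma>"
  obtains c where "c > 0"
    "\<And>u v s t.
      \<lbrakk>mild_solution (generator_dom V d) (generator V d \<alpha> \<beta> \<gamma>) (\<lambda>t. (u t, v t));
       \<gamma> (v 0) \<in> d ` V; 0 \<le> s; s \<le> t\<rbrakk> \<Longrightarrow>
      inner (\<alpha> (u t)) (u t) + inner (\<gamma> (v t)) (v t)
        \<le> 3 * exp (- c * (t - s)) * (inner (\<alpha> (u s)) (u s) + inner (\<gamma> (v s)) (v s))"
proof -
  obtain c where c: "c > 0" and strict:
    "\<And>u u' v v' s t.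
      \<lbrakk>continuous_on {0..} u; continuous_on {0..} v;
       \<And>t. t > 0 \<Longrightarrow> (u has_vector_derivative u' t) (at t);
       \<And>t. t > 0 \<Longrightarrow> (v has_vector_derivative v' t) (at t);
       \<And>t. t > 0 \<Longrightarrow> u t \<in> V; \<And>t. t > 0 \<Longrightarrow> v t \<in> adjoint_dom V d;
       \<And>t. t > 0 \<Longrightarrow> \<alpha> (u' t) = adjoint_op V d (v t) - \<beta> (u t);
       \<And>t. t > 0 \<Longrightarrow> \<gamma> (v' t) = - d (u t);
       \<And>t. t > 0 \<Longrightarrow> \<gamma> (v t) \<in> d ` V; 0 \<le> s; s \<le> t\<rbrakk> \<Longrightarrow>
      inner (\<alpha> (u t)) (u t) + inner (\<gamma> (v t)) (v t)
        \<le> 3 * exp (- c * (t - s)) * (inner (\<alpha> (u s)) (u s) + inner (\<gamma> (v s)) (v s))"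
    by (fact strict_solution_decay[OF d closed_range \<alpha> \<beta> \<gamma>])
  have V: "subspace V" using d by (simp add: closed_densely_defined_op_def)
  have lin: "bounded_linear \<alpha>" "bounded_linear \<beta>" "bounded_linear \<gamma>"
    and bij: "bij \<alpha>" "bij \<gamma>"
    using \<alpha> \<beta> \<gamma> by (simp_all add: selfadjoint_positive_iso_def)
  interpret \<alpha>: bounded_linear \<alpha> by (rule lin)
  interpret \<beta>: bounded_linear \<beta> by (rule lin)
  interpret \<gamma>: bounded_linear \<gamma> by (rule lin)
  note R = subspace_range[OF d]
  show thesis
  proof (rule that[OF c])
    fix u v and s t :: real
    assume mild: "mild_solution (generator_dom V d) (generator V d \<alpha> \<beta> \<gamma>) (\<lambda>t. (u t, v t))"
      and comp: "\<gamma> (v 0) \<in> d ` V" and st: "0 \<le> s" "s \<le> t"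
    define X where "X t = integral {0..t} (\<lambda>t. (u t, v t))" for t
    define U where "U t = fst (X t)" for t
    define Q where "Q t = snd (X t)" for t
    have cont: "continuous_on {0..} (\<lambda>t. (u t, v t))"
      and X_dom: "\<And>r. r \<ge> 0 \<Longrightarrow> X r \<in> generator_dom V d"
      and X_eq: "\<And>r. r \<ge> 0 \<Longrightarrow> (u r, v r) = (u 0, v 0) + generator V d \<alpha> \<beta> \<gamma> (X r)"
      using mild unfolding mild_solution_def X_def by blast+
    have mem: "U r \<in> V" "Q r \<in> adjoint_dom V d" if "r \<ge> 0" for r
      using X_dom[OF that] by (auto simp: U_def Q_def generator_dom_def)
    have eqs: "\<alpha> (u r) = \<alpha> (u 0) + (adjoint_op V d (Q r) - \<beta> (U r))" "\<gamma> (v r) = \<gamma> (v 0) - d (U r)"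
      if "r \<ge> 0" for r
    proof -
      note X_eq[OF that]
      then have "u r = u 0 + inv \<alpha> (adjoint_op V d (Q r) - \<beta> (U r))" "v r = v 0 - inv \<gamma> (d (U r))"
        by (simp_all add: generator_def U_def Q_def split_beta)
      then show "\<alpha> (u r) = \<alpha> (u 0) + (adjoint_op V d (Q r) - \<beta> (U r))"
          "\<gamma> (v r) = \<gamma> (v 0) - d (U r)"
        using bij by (simp_all add: \<alpha>.add \<gamma>.diff surj_f_inv_f bij_is_surj)
    qed
    have vR: "\<gamma> (v r) \<in> d ` V" if "r \<ge> 0" for r
      unfolding eqs(2)[OF that] using R comp mem(1)[OF that] by (intro subspace_diff) auto
    \<comment> \<open>Here the closedness of the range is used once more: the integral stays in it.\<close>
    have QR: "\<gamma> (Q r) \<in> d ` V" if "r \<ge> 0" for r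
    proof -
      have "continuous_on {0..r} (\<lambda>t. (u t, v t))" by (rule continuous_on_subset[OF cont]) auto
      then have int: "(\<lambda>t. (u t, v t)) integrable_on {0..r}" by (rule integrable_continuous_real)
      have lin': "bounded_linear (\<lambda>p. \<gamma> (snd p))"
        by (rule bounded_linear_compose[OF lin(3) bounded_linear_snd])
      have "\<gamma> (Q r) = integral {0..r} ((\<lambda>p. \<gamma> (snd p)) \<circ> (\<lambda>t. (u t, v t)))"
        using integral_linear[OF int lin'] by (simp add: Q_def X_def)
      also have "\<dots> \<in> d ` V"
        using vR integrable_linear[OF int lin']
        by (intro integral_in_closed_subspace R closed_range) auto
      finally show ?thesis .
    qed
    have X_der: "(X has_vector_derivative (u r, v r)) (at r within {0..})" if "r \<ge> 0" for r
      unfolding X_def using integral_has_vector_derivative_atLeast[OF cont that] .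
    have U_der: "(U has_vector_derivative u r) (at r within {0..})"
      and Q_der: "(Q has_vector_derivative v r) (at r within {0..})" if "r \<ge> 0" for r
      using bounded_linear.has_vector_derivative[OF bounded_linear_fst X_der[OF that]]
        bounded_linear.has_vector_derivative[OF bounded_linear_snd X_der[OF that]]
      by (simp_all add: U_def[abs_def] Q_def[abs_def])
    have at_pos: "at r within {0..} = at r" if "r > 0" for r :: real
      using that by (intro at_within_interior) (simp add: interior_Ici)
    have U_cont: "continuous_on {0..} U" and Q_cont: "continuous_on {0..} Q"
      using U_der Q_der by (auto intro: continuous_on_vector_derivative)
    define u_avg where "u_avg n t = real (Suc n) *\<^sub>R (U (t + 1 / real (Suc n)) - U t)" for n t
    define v_avg where "v_avg n t = real (Suc n) *\<^sub>R (Q (t + 1 / real (Suc n)) - Q t)" for n t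
    have avg_decay: "inner (\<alpha> (u_avg n t)) (u_avg n t) + inner (\<gamma> (v_avg n t)) (v_avg n t)
        \<le> 3 * exp (- c * (t - s)) *
          (inner (\<alpha> (u_avg n s)) (u_avg n s) + inner (\<gamma> (v_avg n s)) (v_avg n s))" for n
    proof -
      define k where "k = real (Suc n)"
      define h where "h = 1 / k"
      have h: "h > 0" by (simp add: h_def k_def)
      have avg: "u_avg n = (\<lambda>t. k *\<^sub>R (U (t + h) - U t))" "v_avg n = (\<lambda>t. k *\<^sub>R (Q (t + h) - Q t))"
        by (simp_all add: u_avg_def[abs_def] v_avg_def[abs_def] h_def k_def)
      show ?thesis
      proof (rule strict[where u = "u_avg n" and v = "v_avg n"
            and u' = "\<lambda>t. k *\<^sub>R (u (t + h) - u t)" and v' = "\<lambda>t. k *\<^sub>R (v (t + h) - v t)"])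
        show "continuous_on {0..} (u_avg n)" "continuous_on {0..} (v_avg n)"
          unfolding avg using h
          by (auto intro!: continuous_intros U_cont Q_cont continuous_on_compose2[OF U_cont]
              continuous_on_compose2[OF Q_cont])
      next
        fix r :: real assume r: "r > 0"
        then have rh: "r + h > 0" and r0: "r \<ge> 0" and rh0: "r + h \<ge> 0" using h by auto
        have shift: "((\<lambda>t. f (t + h)) has_vector_derivative f') (at r)"
          if "(f has_vector_derivative f') (at (r + h))" for f :: "real \<Rightarrow> 'z::real_normed_vector" and f'
        proof -
          have "((\<lambda>t. t + h) has_vector_derivative 1) (at r)" by (auto intro!: derivative_eq_intros)
          from vector_diff_chain_at[OF this that] show ?thesis by (simp add: o_def)
        qed
        have "(U has_vector_derivative u r) (at r)" "(U has_vector_derivative u (r + h)) (at (r + h))"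
          using U_der[OF r0] U_der[OF rh0] at_pos[OF r] at_pos[OF rh] by simp_all
        then show "(u_avg n has_vector_derivative k *\<^sub>R (u (r + h) - u r)) (at r)"
          unfolding avg
          by (intro bounded_linear.has_vector_derivative[OF bounded_linear_scaleR_right]
              has_vector_derivative_diff shift)
        have "(Q has_vector_derivative v r) (at r)" "(Q has_vector_derivative v (r + h)) (at (r + h))"
          using Q_der[OF r0] Q_der[OF rh0] at_pos[OF r] at_pos[OF rh] by simp_all
        then show "(v_avg n has_vector_derivative k *\<^sub>R (v (r + h) - v r)) (at r)"
          unfolding avg
          by (intro bounded_linear.has_vector_derivative[OF bounded_linear_scaleR_right]
              has_vector_derivative_diff shift)
        show "u_avg n r \<in> V"
          unfolding avg using V mem(1)[OF r0] mem(1)[OF rh0] by (simp add: subspace_diff subspace_scale)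
        show "v_avg n r \<in> adjoint_dom V d"
          unfolding avg by (rule adjoint_op_scaleR_diff[OF d mem(2)[OF rh0] mem(2)[OF r0]])
        have "\<alpha> (k *\<^sub>R (u (r + h) - u r)) = k *\<^sub>R (\<alpha> (u (r + h)) - \<alpha> (u r))"
          by (simp add: \<alpha>.scaleR \<alpha>.diff)
        also have "\<dots> = k *\<^sub>R (adjoint_op V d (Q (r + h)) - adjoint_op V d (Q r))
            - k *\<^sub>R (\<beta> (U (r + h)) - \<beta> (U r))"
          unfolding eqs(1)[OF r0] eqs(1)[OF rh0] scaleR_right_diff_distrib[symmetric]
          by (intro arg_cong[where f = "scaleR k"]) simp
        finally show "\<alpha> (k *\<^sub>R (u (r + h) - u r)) = adjoint_op V d (v_avg n r) - \<beta> (u_avg n r)"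
          unfolding avg adjoint_op_scaleR_diff(2)[OF d mem(2)[OF rh0] mem(2)[OF r0]]
          by (simp add: \<beta>.scaleR \<beta>.diff)
        have "d (u_avg n r) = k *\<^sub>R (d (U (r + h)) - d (U r))"
          unfolding avg using mem(1)[OF r0] mem(1)[OF rh0] V
          by (simp add: closed_densely_defined_op_scaleR[OF d] closed_densely_defined_op_diff[OF d]
              subspace_diff)
        then show "\<gamma> (k *\<^sub>R (v (r + h) - v r)) = - d (u_avg n r)"
          by (simp add: \<gamma>.scaleR \<gamma>.diff eqs(2)[OF r0] eqs(2)[OF rh0] scaleR_right_diff_distrib)
        show "\<gamma> (v_avg n r) \<in> d ` V"
          unfolding avg \<gamma>.scaleR \<gamma>.diff
          by (intro subspace_scale subspace_diff R QR r0 rh0)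
      qed (rule st)+
    qed
    have lim: "(\<lambda>n. inner (\<alpha> (u_avg n r)) (u_avg n r) + inner (\<gamma> (v_avg n r)) (v_avg n r))
        \<longlonglongrightarrow> inner (\<alpha> (u r)) (u r) + inner (\<gamma> (v r)) (v r)" if "r \<ge> 0" for r
      unfolding u_avg_def v_avg_def
      by (intro tendsto_intros \<alpha>.tendsto \<gamma>.tendsto
          has_vector_derivative_imp_difference_quotients[OF U_der[OF that] that]
          has_vector_derivative_imp_difference_quotients[OF Q_der[OF that] that])
    show "inner (\<alpha> (u t)) (u t) + inner (\<gamma> (v t)) (v t)
        \<le> 3 * exp (- c * (t - s)) * (inner (\<alpha> (u s)) (u s) + inner (\<gamma> (v s)) (v s))"
      by (rule LIMSEQ_le[OF lim tendsto_mult_left[OF lim]]) (use st avg_decay in auto)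
  qed
qed

theorem theorem1p1:
  fixes V1 :: "'w1::{real_inner,banach} set"
    and d :: "'w1 \<Rightarrow> 'w2::{real_inner,banach}"
    and \<alpha> \<beta> :: "'w1 \<Rightarrow> 'w1"
    and \<gamma> :: "'w2 \<Rightarrow> 'w2"
  assumes d: "closed_densely_defined_op V1 d"
    and closed_range: "closed (d ` V1)"
    and \<alpha>: "selfadjoint_positive_iso \<alpha>"
    and \<beta>: "selfadjoint_positive_iso \<beta>"
    and \<gamma>: "selfadjoint_positive_iso \<gamma>"
  shows "\<exists>C'>0. \<exists>c'>0. \<forall>(u :: real \<Rightarrow> 'w1) (v :: real \<Rightarrow> 'w2).
    mild_solution (generator_dom V1 d) (generator V1 d \<alpha> \<beta> \<gamma>) (\<lambda>t. (u t, v t)) \<and>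
    \<gamma> (v 0) \<in> d ` V1 \<longrightarrow>
    (\<forall>s t. 0 \<le> s \<and> s \<le> t \<longrightarrow>
      (weighted_norm \<alpha> (u t))\<^sup>2 + (weighted_norm \<gamma> (v t))\<^sup>2
        \<le> C' * exp (- c' * (t - s)) *
          ((weighted_norm \<alpha> (u s))\<^sup>2 + (weighted_norm \<gamma> (v s))\<^sup>2))"
proof -
  obtain c where c: "c > 0" and decay: "\<And>u v s t.
      \<lbrakk>mild_solution (generator_dom V1 d) (generator V1 d \<alpha> \<beta> \<gamma>) (\<lambda>t. (u t, v t));
       \<gamma> (v 0) \<in> d ` V1; 0 \<le> s; s \<le> t\<rbrakk> \<Longrightarrow>
      inner (\<alpha> (u t)) (u t) + inner (\<gamma> (v t)) (v t)
        \<le> 3 * exp (- c * (t - s)) * (inner (\<alpha> (u s)) (u s) + inner (\<gamma> (v s)) (v s))"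
    by (fact mild_solution_decay[OF d closed_range \<alpha> \<beta> \<gamma>])
  have norm_sq: "(weighted_norm T x)\<^sup>2 = inner (T x) x"
    if "selfadjoint_positive_iso T" for T :: "'z::{real_inner,banach} \<Rightarrow> 'z" and x
    using that by (cases "x = 0") (auto simp: weighted_norm_def selfadjoint_positive_iso_def less_imp_le)
  show ?thesis
    unfolding norm_sq[OF \<alpha>] norm_sq[OF \<gamma>]
    by (rule exI[of _ 3], rule conjI, simp, rule exI[of _ c]) (use c decay in blast)
qed

end
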